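(* Let $G(V,E,W)$ be a stochastic-flow network with source node $1$ and sink node $n$, let $d$ be a positive integer, and let $X$ be a $d$-MC candidate in $G(V,E,W)$ with $W(X)=d$. Then $X$ is a $d$-MC if and only if for every $e_i\in U(X)$ there is a path from the source node $1$ to the sink node $n$ in the residual network $R(V,E,(X+0(e_i))^d)$.
   Context: A stochastic-flow network $G(V,E,W)$ has node set $V=\{1,2,\dots,n\}$, with node $1$ the source and node $n$ the sink, edge (arc) set $E=\{e_1,\dots,e_m\}$, and non-negative integer max-capacities $W(e_i)$, $i=1,\dots,m$. Edges may be directed or undirected, with the usual notions of flow and path in each case. A system-state vector is $X=(x_1,\dots,x_m)$, where the non-negative integer $x_i=X(e_i)\le W(e_i)$ is the current capacity of $e_i$. $G(V,E,X)$ denotes the network with the same nodes and edges in which $e_i$ has capacity $X(e_i)$. $W(X)$ denotes the value of a maximum flow from node $1$ to node $n$ in $G(V,E,X)$. $0(e_i)$ denotes the vector with entry $1$ at $e_i$ and $0$ at all other arcs; sums of vectors are componentwise. $U(X)=\{e_i\in E : X(e_i)<W(e_i)\}$. A minimal cut (MC) is an inclusion-minimal set of edges whose removal leaves no path from node $1$ to node $n$. A $d$-MC candidate generated from an MC $C$ is a system-state vector $X$ with non-negative integer entries such that $X(e)\le W(e)$ for all $e\in C$, $\sum_{e\in C}X(e)=d$, and $X(e)=W(e)$ for all $e\notin C$. A $d$-MC candidate is a vector that is a $d$-MC candidate generated from some MC. A system-state vector $X$ is a $d$-MC if and only if $W(X)=d$ and $W(X+0(e_i))>d$ for every $e_i\in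 U(X)$. For a system-state vector $Y$ with $W(Y)\ge d$, $R(V,E,Y^d)$ denotes the residual network of $G(V,E,Y)$ after sending $d$ units of flow from node $1$ to node $n$, that is, the residual network with respect to a feasible integer flow of value $d$ (any such flow may be used). For a directed arc $(u,v)$ of capacity $y$ carrying flow $f$, the residual capacity is $y-f$ from $u$ to $v$ and $f$ from $v$ to $u$. For an undirected edge $\{u,v\}$ of capacity $y$ carrying net flow $f$ from $u$ to $v$, it is $y-f$ from $u$ to $v$ and $y+f$ from $v$ to $u$. A path in the residual network uses only positive residual capacities. *)

theory Defs
  imports Complex_Main "Graph_Theory.Arc_Walk"
begin

text \<open>
  A network is given by a digraph \<open>G\<close> on the nodes \<open>{1..n}\<close> together with the set
  \<open>UE\<close> of those edges that are undirected; the remaining edges are directed from tail to head.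
  For an edge in \<open>UE\<close> the tail and head only serve to fix a sign convention for net flow.
\<close>

definition stochastic_flow_network :: "(nat, 'e) pre_digraph \<Rightarrow> 'e set \<Rightarrow> nat \<Rightarrow> bool" where
  "stochastic_flow_network G UE n \<longleftrightarrow>
     fin_digraph G \<and> verts G = {1..n} \<and> 2 \<le> n \<and> UE \<subseteq> arcs G"

text \<open>
  Capacity vectors are functions on edges; only their values on \<open>arcs G\<close> are relevant.
\<close>

definition system_state :: "(nat, 'e) pre_digraph \<Rightarrow> ('e \<Rightarrow> nat) \<Rightarrow> ('e \<Rightarrow> nat) \<Rightarrow> bool" where
  "system_state G W X \<longleftrightarrow> (\<forall>e\<in>arcs G. X e \<le> W e)"

definition unit_state :: "'e \<Rightarrow> 'e \<Rightarrow> nat" where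
  "unit_state e = (\<lambda>e'. if e' = e then 1 else 0)"

definition add_state :: "('e \<Rightarrow> nat) \<Rightarrow> ('e \<Rightarrow> nat) \<Rightarrow> 'e \<Rightarrow> nat" where
  "add_state X Y = (\<lambda>e. X e + Y e)"

definition unsaturated :: "(nat, 'e) pre_digraph \<Rightarrow> ('e \<Rightarrow> nat) \<Rightarrow> ('e \<Rightarrow> nat) \<Rightarrow> 'e set" where
  "unsaturated G W X = {e \<in> arcs G. X e < W e}"


text \<open>
  A step is an edge together with the direction in which it is traversed; \<open>steps_digraph G S\<close>
  is the digraph on the nodes of \<open>G\<close> whose arcs are the steps in \<open>S\<close>.
\<close>

datatype direction = Forward | Backward

fun step_tail :: "('a, 'e) pre_digraph \<Rightarrow> 'e \<times> direction \<Rightarrow> 'a" where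
  "step_tail G (e, Forward) = tail G e"
| "step_tail G (e, Backward) = head G e"

fun step_head :: "('a, 'e) pre_digraph \<Rightarrow> 'e \<times> direction \<Rightarrow> 'a" where
  "step_head G (e, Forward) = head G e"
| "step_head G (e, Backward) = tail G e"

definition steps_digraph ::
    "('a, 'e) pre_digraph \<Rightarrow> ('e \<times> direction) set \<Rightarrow> ('a, 'e \<times> direction) pre_digraph" where
  "steps_digraph G S =
     \<lparr>verts = verts G, arcs = S, tail = step_tail G, head = step_head G\<rparr>"

definition has_path :: "('a, 'b) pre_digraph \<Rightarrow> 'a \<Rightarrow> 'a \<Rightarrow> bool" where
  "has_path D u v \<longleftrightarrow> (\<exists>p. pre_digraph.apath D u p v)"

definition remaining_network ::
    "(nat, 'e) pre_digraph \<Rightarrow> 'e set \<Rightarrow> 'e set \<Rightarrow> (nat, 'e \<times> direction) pre_digraph" where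
  "remaining_network G UE C =
     steps_digraph G {(e, b). e \<in> arcs G - C \<and> (b = Forward \<or> e \<in> UE)}"

definition disconnecting :: "(nat, 'e) pre_digraph \<Rightarrow> 'e set \<Rightarrow> nat \<Rightarrow> 'e set \<Rightarrow> bool" where
  "disconnecting G UE n C \<longleftrightarrow> C \<subseteq> arcs G \<and> \<not> has_path (remaining_network G UE C) 1 n"

definition minimal_cut :: "(nat, 'e) pre_digraph \<Rightarrow> 'e set \<Rightarrow> nat \<Rightarrow> 'e set \<Rightarrow> bool" where
  "minimal_cut G UE n C \<longleftrightarrow>
     disconnecting G UE n C \<and> (\<forall>C'. C' \<subset> C \<longrightarrow> \<not> disconnecting G UE n C')"


text \<open>
  On an undirected edge, \<open>f e\<close> is the net flow from tail to head and may be negative.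
\<close>

definition feasible_flow ::
    "(nat, 'e) pre_digraph \<Rightarrow> 'e set \<Rightarrow> nat \<Rightarrow> ('e \<Rightarrow> nat) \<Rightarrow> ('e \<Rightarrow> real) \<Rightarrow> bool" where
  "feasible_flow G UE n X f \<longleftrightarrow>
     (\<forall>e\<in>arcs G. if e \<in> UE then \<bar>f e\<bar> \<le> real (X e) else 0 \<le> f e \<and> f e \<le> real (X e)) \<and>
     (\<forall>v\<in>verts G - {1, n}. (\<Sum>e\<in>in_arcs G v. f e) = (\<Sum>e\<in>out_arcs G v. f e))"

definition flow_value :: "(nat, 'e) pre_digraph \<Rightarrow> ('e \<Rightarrow> real) \<Rightarrow> real" where
  "flow_value G f = (\<Sum>e\<in>out_arcs G 1. f e) - (\<Sum>e\<in>in_arcs G 1. f e)"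

definition max_flow_value ::
    "(nat, 'e) pre_digraph \<Rightarrow> 'e set \<Rightarrow> nat \<Rightarrow> ('e \<Rightarrow> nat) \<Rightarrow> real" where
  "max_flow_value G UE n X =
     (GREATEST r. \<exists>f. feasible_flow G UE n X f \<and> r = flow_value G f)"

definition integer_flow_of_value ::
    "(nat, 'e) pre_digraph \<Rightarrow> 'e set \<Rightarrow> nat \<Rightarrow> ('e \<Rightarrow> nat) \<Rightarrow> nat \<Rightarrow> ('e \<Rightarrow> real) \<Rightarrow> bool" where
  "integer_flow_of_value G UE n X d f \<longleftrightarrow>
     feasible_flow G UE n X f \<and> (\<forall>e\<in>arcs G. f e \<in> \<int>) \<and> flow_value G f = real d"

fun residual_capacity ::
    "'e set \<Rightarrow> ('e \<Rightarrow> nat) \<Rightarrow> ('e \<Rightarrow> real) \<Rightarrow> 'e \<times> direction \<Rightarrow> real" where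
  "residual_capacity UE Y f (e, Forward) = real (Y e) - f e"
| "residual_capacity UE Y f (e, Backward) = (if e \<in> UE then real (Y e) + f e else f e)"

definition residual_network ::
    "(nat, 'e) pre_digraph \<Rightarrow> 'e set \<Rightarrow> ('e \<Rightarrow> nat) \<Rightarrow> ('e \<Rightarrow> real) \<Rightarrow>
     (nat, 'e \<times> direction) pre_digraph" where
  "residual_network G UE Y f =
     steps_digraph G {(e, b). e \<in> arcs G \<and> 0 < residual_capacity UE Y f (e, b)}"


definition d_MC_candidate_from ::
    "(nat, 'e) pre_digraph \<Rightarrow> ('e \<Rightarrow> nat) \<Rightarrow> nat \<Rightarrow> 'e set \<Rightarrow> ('e \<Rightarrow> nat) \<Rightarrow> bool" where
  "d_MC_candidate_from G W d C X \<longleftrightarrow>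
     system_state G W X \<and> (\<forall>e\<in>C. X e \<le> W e) \<and> (\<Sum>e\<in>C. X e) = d \<and>
     (\<forall>e\<in>arcs G - C. X e = W e)"

definition d_MC_candidate ::
    "(nat, 'e) pre_digraph \<Rightarrow> 'e set \<Rightarrow> nat \<Rightarrow> ('e \<Rightarrow> nat) \<Rightarrow> nat \<Rightarrow> ('e \<Rightarrow> nat) \<Rightarrow> bool" where
  "d_MC_candidate G UE n W d X \<longleftrightarrow>
     (\<exists>C. minimal_cut G UE n C \<and> d_MC_candidate_from G W d C X)"

definition d_MC ::
    "(nat, 'e) pre_digraph \<Rightarrow> 'e set \<Rightarrow> nat \<Rightarrow> ('e \<Rightarrow> nat) \<Rightarrow> nat \<Rightarrow> ('e \<Rightarrow> nat) \<Rightarrow> bool" where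
  "d_MC G UE n W d X \<longleftrightarrow>
     system_state G W X \<and> max_flow_value G UE n X = real d \<and>
     (\<forall>e\<in>unsaturated G W X. max_flow_value G UE n (add_state X (unit_state e)) > real d)"

end

theory Submission
  imports Defs
begin

text \<open>
  A candidate \<open>X\<close> whose maximum flow is \<open>d\<close> is a \<open>d\<close>-MC when raising any single unsaturated
  edge \<open>e\<close> by one unit makes the maximum flow exceed \<open>d\<close>. A flow of value \<open>d\<close> in the network with capacities \<open>X + 0(e)\<close> is
  thus to be tested for maximality, and the test is the classical one of Ford and Fulkerson: a
  flow is maximum iff its residual network has no path from source to sink.

  Two lemmas carry this test. If there is a residual path, pushing one unit along it keeps an
  integer flow feasible and raises its value by one (\<open>augmenting_path\<close>). If there is none, the
  nodes that the source reaches in the residual network form a cut across which the flow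
  already sends as much as the capacities allow, so no flow can send more
  (\<open>flow_maximum_if_no_residual_path\<close>).

  Together they also show that the maximum exists and is attained by an integer flow
  (\<open>ex_maximum_integer_flow\<close>): the values of integer flows are bounded, and an integer flow of
  largest value has no augmenting path, hence is maximum among all real flows as well. Applied
  to \<open>X\<close>, this gives an integer flow of value \<open>d\<close>, which stays feasible when a capacity is
  raised; so the residual networks in the theorem exist.
\<close>

section \<open>Net outflow\<close>

definition net_outflow :: "('a, 'e) pre_digraph \<Rightarrow> ('e \<Rightarrow> real) \<Rightarrow> 'a \<Rightarrow> real" where
  "net_outflow G f v = (\<Sum>e\<in>out_arcs G v. f e) - (\<Sum>e\<in>in_arcs G v. f e)"

text \<open>
  As a single sum over all arcs, the net outflow is visibly linear in the flow and easy to sum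
  over a set of nodes; a loop contributes zero.
\<close>

lemma net_outflow_eq_sum_arcs:
  assumes "finite (arcs G)"
  shows "net_outflow G f v =
    (\<Sum>e\<in>arcs G. f e * (of_bool (tail G e = v) - of_bool (head G e = v)))"
proof -
  have "(\<Sum>e\<in>out_arcs G v. f e) = (\<Sum>e\<in>arcs G. f e * of_bool (tail G e = v))"
    by (rule sum.mono_neutral_cong_left) (use assms in \<open>auto simp: out_arcs_def\<close>)
  moreover have "(\<Sum>e\<in>in_arcs G v. f e) = (\<Sum>e\<in>arcs G. f e * of_bool (head G e = v))"
    by (rule sum.mono_neutral_cong_left) (use assms in \<open>auto simp: in_arcs_def\<close>)
  ultimately show ?thesis
    by (simp add: net_outflow_def right_diff_distrib sum_subtractf)
qed

lemma net_outflow_add: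
  "net_outflow G (\<lambda>e. f e + g e) v = net_outflow G f v + net_outflow G g v"
  by (simp add: net_outflow_def sum.distrib)

lemma sum_net_outflow:
  assumes "finite (arcs G)" "finite S"
  shows "(\<Sum>v\<in>S. net_outflow G f v) =
    (\<Sum>e\<in>arcs G. f e * (of_bool (tail G e \<in> S) - of_bool (head G e \<in> S)))"
proof -
  have in_S: "(\<Sum>v\<in>S. of_bool (w = v)) = (of_bool (w \<in> S) :: real)" for w
    using assms(2) by (simp add: of_bool_def)
  have "(\<Sum>v\<in>S. net_outflow G f v) =
    (\<Sum>v\<in>S. \<Sum>e\<in>arcs G. f e * (of_bool (tail G e = v) - of_bool (head G e = v)))"
    using assms(1) by (simp add: net_outflow_eq_sum_arcs)
  also have "\<dots> =
    (\<Sum>e\<in>arcs G. \<Sum>v\<in>S. f e * (of_bool (tail G e = v) - of_bool (head G e = v)))"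
    by (rule sum.swap)
  also have "\<dots> =
    (\<Sum>e\<in>arcs G. f e * (of_bool (tail G e \<in> S) - of_bool (head G e \<in> S)))"
    by (simp only: sum_distrib_left[symmetric] sum_subtractf in_S)
  finally show ?thesis .
qed

lemma flow_value_eq_net_outflow: "flow_value G f = net_outflow G f 1"
  by (simp add: flow_value_def net_outflow_def)

lemma feasible_flow_conservation:
  assumes "feasible_flow G UE n Y f" "v \<in> verts G" "v \<noteq> 1" "v \<noteq> n"
  shows "net_outflow G f v = 0"
  using assms by (simp add: feasible_flow_def net_outflow_def)

text \<open>
  By conservation only the source contributes to the sum, so the value of a flow can be read off
  from any cut that separates the source from the sink.
\<close>

lemma flow_value_eq_sum_net_outflow:
  assumes "feasible_flow G UE n Y f" "finite S" "S \<subseteq> verts G" "1 \<in> S" "n \<notin> S"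
  shows "flow_value G f = (\<Sum>v\<in>S. net_outflow G f v)"
proof -
  have "(\<Sum>v\<in>S - {1}. net_outflow G f v) = 0"
    using assms by (intro sum.neutral ballI feasible_flow_conservation) auto
  then show ?thesis
    using assms by (simp add: sum.remove[of S 1] flow_value_eq_net_outflow)
qed

lemma feasible_flow_mono:
  assumes "feasible_flow G UE n Y f" "\<And>e. e \<in> arcs G \<Longrightarrow> Y e \<le> Z e"
  shows "feasible_flow G UE n Z f"
proof -
  have "real (Y e) \<le> real (Z e)" if "e \<in> arcs G" for e
    using assms(2) that by simp
  then show ?thesis
    using assms(1) unfolding feasible_flow_def by (auto split: if_splits intro: order_trans)
qed

lemma flow_value_le_capacities:
  assumes "finite (arcs G)" "feasible_flow G UE n Y f"
  shows "flow_value G f \<le> (\<Sum>e\<in>arcs G. real (Y e))"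
  unfolding flow_value_eq_net_outflow net_outflow_eq_sum_arcs[OF assms(1)]
proof (rule sum_mono)
  fix e assume "e \<in> arcs G"
  then have "\<bar>f e\<bar> \<le> real (Y e)"
    using assms(2) by (auto simp: feasible_flow_def split: if_splits)
  then show "f e * (of_bool (tail G e = 1) - of_bool (head G e = 1)) \<le> real (Y e)"
    by auto
qed

section \<open>Paths made of steps\<close>

lemma steps_digraph_simps [simp]:
  "verts (steps_digraph G S) = verts G" "arcs (steps_digraph G S) = S"
  "tail (steps_digraph G S) = step_tail G" "head (steps_digraph G S) = step_head G"
  by (simp_all add: steps_digraph_def)

lemma wf_steps_digraph:
  assumes "wf_digraph G" "S \<subseteq> arcs G \<times> UNIV"
  shows "wf_digraph (steps_digraph G S)"
proof
  fix s assume "s \<in> arcs (steps_digraph G S)"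
  then obtain e b where s: "s = (e, b)" "e \<in> arcs G"
    using assms(2) by auto
  then show "tail (steps_digraph G S) s \<in> verts (steps_digraph G S)"
    and "head (steps_digraph G S) s \<in> verts (steps_digraph G S)"
    using assms(1)
    by (cases b; simp add: wf_digraph.tail_in_verts wf_digraph.head_in_verts)+
qed

lemma residual_network_steps:
  "arcs (residual_network G UE Y f) \<subseteq> arcs G \<times> UNIV"
  by (auto simp: residual_network_def)

lemma wf_residual_network:
  assumes "wf_digraph G"
  shows "wf_digraph (residual_network G UE Y f)"
  unfolding residual_network_def using assms by (rule wf_steps_digraph) auto

lemma has_path_iff_reachable:
  assumes "wf_digraph D"
  shows "has_path D u v \<longleftrightarrow> u \<rightarrow>\<^sup>*\<^bsub>D\<^esub> v"
  using wf_digraph.reachable_apath[OF assms] by (simp add: has_path_def)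

text \<open>
  One unit of flow along \<open>p\<close>. Counting occurrences, instead of testing membership, makes it
  additive in \<open>p\<close>, which is what induction over a walk needs.
\<close>

definition path_flow :: "('e \<times> direction) list \<Rightarrow> 'e \<Rightarrow> real" where
  "path_flow p e = real (count_list p (e, Forward)) - real (count_list p (e, Backward))"

lemma net_outflow_single_step:
  assumes "finite (arcs G)" "fst s \<in> arcs G"
  shows "net_outflow G (path_flow [s]) v =
    of_bool (step_tail G s = v) - of_bool (step_head G s = v)"
proof -
  obtain e b where s: "s = (e, b)" by (cases s)
  have "net_outflow G (path_flow [s]) v =
    (\<Sum>a\<in>arcs G. if a = e
       then path_flow [s] e * (of_bool (tail G e = v) - of_bool (head G e = v)) else 0)"
    unfolding net_outflow_eq_sum_arcs[OF assms(1)]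
    by (rule sum.cong) (auto simp: path_flow_def s)
  also have "\<dots> = path_flow [s] e * (of_bool (tail G e = v) - of_bool (head G e = v))"
    using assms s by simp
  also have "\<dots> = of_bool (step_tail G s = v) - of_bool (step_head G s = v)"
    by (cases b) (simp_all add: path_flow_def s)
  finally show ?thesis .
qed

text \<open>
  Along a walk the contributions telescope: every unit that enters an inner node leaves it again.
\<close>

lemma net_outflow_path_flow:
  assumes "fin_digraph G" "S \<subseteq> arcs G \<times> UNIV"
    and "pre_digraph.awalk (steps_digraph G S) u p w"
  shows "net_outflow G (path_flow p) v = of_bool (u = v) - of_bool (w = v)"
proof -
  interpret fin_digraph G by fact
  interpret R: wf_digraph "steps_digraph G S"
    using wf_digraph_axioms assms(2) by (rule wf_steps_digraph)
  show ?thesis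
    using assms(3)
  proof (induction p arbitrary: u)
    case Nil
    then have "u = w"
      by (simp add: pre_digraph.awalk_def pre_digraph.cas.simps)
    then show ?case
      by (simp add: path_flow_def net_outflow_def)
  next
    case (Cons s p)
    have s: "s \<in> S" "step_tail G s = u" and walk: "R.awalk (step_head G s) p w"
      using Cons.prems by (auto simp: R.awalk_Cons_iff)
    from walk
    have IH: "net_outflow G (path_flow p) v = of_bool (step_head G s = v) - of_bool (w = v)"
      by (rule Cons.IH)
    have "path_flow (s # p) = (\<lambda>e. path_flow [s] e + path_flow p e)"
      by (auto simp: path_flow_def)
    moreover have "fst s \<in> arcs G"
      using s(1) assms(2) by auto
    ultimately show ?case
      by (simp add: net_outflow_add net_outflow_single_step finite_arcs IH s(2))
  qed
qed

section \<open>Residual paths and maximality\<close>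

text \<open>
  For an integer flow all residual capacities are integers, so a positive one leaves room for a
  whole unit. A simple path uses each step at most once, and if it used an edge in both
  directions, the two contributions would cancel.
\<close>

lemma augmenting_path:
  assumes "fin_digraph G" "1 \<noteq> n"
    and f: "integer_flow_of_value G UE n Y k f"
    and path: "has_path (residual_network G UE Y f) 1 n"
  shows "\<exists>g. integer_flow_of_value G UE n Y (Suc k) g"
proof -
  interpret fin_digraph G by fact
  define S where "S = arcs (residual_network G UE Y f)"
  have net: "residual_network G UE Y f = steps_digraph G S"
    by (simp add: S_def residual_network_def)
  have S: "S \<subseteq> arcs G \<times> UNIV"
    unfolding S_def by (rule residual_network_steps)
  obtain p where p: "pre_digraph.apath (steps_digraph G S) 1 p n"
    using path by (auto simp: has_path_def net)
  interpret R: wf_digraph "steps_digraph G S"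
    using wf_digraph_axioms S by (rule wf_steps_digraph)
  have walk: "R.awalk 1 p n" and "distinct p"
    using p R.distinct_verts_imp_distinct by (auto simp: R.apath_def)
  have p_S: "set p \<subseteq> S"
    using walk by (auto simp: R.awalk_def)
  define g where "g = (\<lambda>e. f e + path_flow p e)"
  have feasible: "feasible_flow G UE n Y f"
    and int: "\<And>e. e \<in> arcs G \<Longrightarrow> f e \<in> \<int>"
    and val: "flow_value G f = real k"
    using f by (auto simp: integer_flow_of_value_def)
  have room: "1 \<le> residual_capacity UE Y f s" if "s \<in> set p" for s
  proof -
    obtain e b where s: "s = (e, b)" by (cases s)
    have "0 < residual_capacity UE Y f s" "e \<in> arcs G"
      using that p_S s by (auto simp: S_def residual_network_def)
    moreover have "residual_capacity UE Y f s \<in> \<int>"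
      using int[OF \<open>e \<in> arcs G\<close>] by (cases b) (auto simp: s)
    ultimately show ?thesis
      by (auto elim!: Ints_cases)
  qed
  have count: "count_list p s = of_bool (s \<in> set p)" for s
    using \<open>distinct p\<close> by (induction p) auto
  have bounds: "if e \<in> UE then \<bar>g e\<bar> \<le> real (Y e) else 0 \<le> g e \<and> g e \<le> real (Y e)"
    if "e \<in> arcs G" for e
  proof -
    have old: "if e \<in> UE then \<bar>f e\<bar> \<le> real (Y e) else 0 \<le> f e \<and> f e \<le> real (Y e)"
      using feasible that by (simp add: feasible_flow_def)
    have "1 \<le> real (Y e) - f e" if "(e, Forward) \<in> set p"
      using room[OF that] by simp
    moreover have "1 \<le> (if e \<in> UE then real (Y e) + f e else f e)" if "(e, Backward) \<in> set p"
      using room[OF that] by simp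
    ultimately show ?thesis
      using old
      by (cases "(e, Forward) \<in> set p"; cases "(e, Backward) \<in> set p")
         (auto simp: g_def path_flow_def count split: if_splits)
  qed
  have outflow: "net_outflow G g v = net_outflow G f v + (of_bool (1 = v) - of_bool (n = v))" for v
    unfolding g_def net_outflow_add using net_outflow_path_flow[OF assms(1) S walk] by simp
  have "net_outflow G g v = 0" if "v \<in> verts G - {1, n}" for v
    using that feasible_flow_conservation[OF feasible, of v] outflow[of v] by auto
  then have "feasible_flow G UE n Y g"
    using bounds by (simp add: feasible_flow_def net_outflow_def)
  moreover have "\<forall>e\<in>arcs G. g e \<in> \<int>"
    using int by (auto simp: g_def path_flow_def)
  moreover have "flow_value G g = real (Suc k)"
    using val outflow[of 1] \<open>1 \<noteq> n\<close> by (simp add: flow_value_eq_net_outflow)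
  ultimately show ?thesis
    by (auto simp: integer_flow_of_value_def)
qed

text \<open>
  Let \<open>S\<close> be the set of nodes that the source reaches in the residual network. No residual step
  leaves \<open>S\<close>, so \<open>f\<close> is at its upper bound on every edge with only its tail in \<open>S\<close> and at
  its lower bound (zero, or minus the capacity if the edge is undirected) on every edge with only
  its head in \<open>S\<close>. The value of any flow is its net flow out of \<open>S\<close>, which
  is therefore largest for \<open>f\<close>.
\<close>

lemma flow_maximum_if_no_residual_path:
  assumes "fin_digraph G" "1 \<in> verts G"
    and f: "feasible_flow G UE n Y f"
    and g: "feasible_flow G UE n Y g"
    and no_path: "\<not> has_path (residual_network G UE Y f) 1 n"
  shows "flow_value G g \<le> flow_value G f"
proof -
  interpret fin_digraph G by fact
  define R where "R = residual_network G UE Y f"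
  interpret R: wf_digraph R
    unfolding R_def using wf_digraph_axioms by (rule wf_residual_network)
  have verts_R: "verts R = verts G"
    by (simp add: R_def residual_network_def)
  define S where "S = {v. 1 \<rightarrow>\<^sup>*\<^bsub>R\<^esub> v}"
  have S: "S \<subseteq> verts G"
    using R.reachable_in_verts(2) by (auto simp: S_def verts_R)
  then have "finite S"
    using finite_verts by (rule finite_subset)
  have "1 \<in> S"
    using assms(2) by (simp add: S_def verts_R)
  have "n \<notin> S"
    using no_path R.wf_digraph_axioms by (simp add: S_def has_path_iff_reachable flip: R_def)
  have closed: "step_head G s \<in> S" if "s \<in> arcs R" "step_tail G s \<in> S" for s
  proof -
    have "step_tail G s \<rightarrow>\<^bsub>R\<^esub> step_head G s"
      using R.in_arcs_imp_in_arcs_ends[OF that(1)]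
      by (simp add: R_def residual_network_def arc_to_ends_def)
    then show ?thesis
      using that(2) R.reachable_adj_trans by (auto simp: S_def)
  qed
  have "(\<Sum>v\<in>S. net_outflow G g v) \<le> (\<Sum>v\<in>S. net_outflow G f v)"
    unfolding sum_net_outflow[OF finite_arcs \<open>finite S\<close>]
  proof (rule sum_mono)
    fix e assume e: "e \<in> arcs G"
    have g_bounds: "if e \<in> UE then \<bar>g e\<bar> \<le> real (Y e) else 0 \<le> g e \<and> g e \<le> real (Y e)"
      using g e by (simp add: feasible_flow_def)
    have saturated: "residual_capacity UE Y f (e, b) \<le> 0"
      if "step_tail G (e, b) \<in> S" "step_head G (e, b) \<notin> S" for b
    proof (rule ccontr)
      assume "\<not> residual_capacity UE Y f (e, b) \<le> 0"
      then have "(e, b) \<in> arcs R"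
        using e by (simp add: R_def residual_network_def)
      then show False
        using closed that by blast
    qed
    have leaving: "g e \<le> f e" if "tail G e \<in> S" "head G e \<notin> S"
      using saturated[of Forward] that g_bounds by (auto split: if_splits)
    have entering: "f e \<le> g e" if "tail G e \<notin> S" "head G e \<in> S"
      using saturated[of Backward] that g_bounds by (auto split: if_splits)
    show "g e * (of_bool (tail G e \<in> S) - of_bool (head G e \<in> S))
        \<le> f e * (of_bool (tail G e \<in> S) - of_bool (head G e \<in> S))"
      using leaving entering by (cases "tail G e \<in> S"; cases "head G e \<in> S") auto
  qed
  then show ?thesis
    using flow_value_eq_sum_net_outflow[OF f \<open>finite S\<close> S \<open>1 \<in> S\<close> \<open>n \<notin> S\<close>]
      flow_value_eq_sum_net_outflow[OF g \<open>finite S\<close> S \<open>1 \<in> S\<close> \<open>n \<notin> S\<close>]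
    by simp
qed

section \<open>The maximum flow\<close>

lemma max_flow_value_eqI:
  assumes "feasible_flow G UE n Y f"
    and "\<And>g. feasible_flow G UE n Y g \<Longrightarrow> flow_value G g \<le> flow_value G f"
  shows "max_flow_value G UE n Y = flow_value G f"
  unfolding max_flow_value_def by (rule Greatest_equality) (use assms in auto)

text \<open>
  Maximality among integer flows is a matter of a bounded set of natural numbers; the absence of
  an augmenting path then carries it over to real flows. In particular the greatest value in the
  definition of \<open>max_flow_value\<close> exists, without any appeal to compactness.
\<close>

lemma ex_maximum_integer_flow:
  assumes "fin_digraph G" "1 \<in> verts G" "1 \<noteq> n"
  obtains k f where "integer_flow_of_value G UE n Y k f" "max_flow_value G UE n Y = real k"
    and "\<And>g. feasible_flow G UE n Y g \<Longrightarrow> flow_value G g \<le> real k"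
proof -
  interpret fin_digraph G by fact
  define P where "P k \<longleftrightarrow> (\<exists>f. integer_flow_of_value G UE n Y k f)" for k
  have "P 0"
    unfolding P_def
    by (rule exI[of _ "\<lambda>_. 0"])
       (simp add: integer_flow_of_value_def feasible_flow_def flow_value_def)
  moreover have "k \<le> (\<Sum>e\<in>arcs G. Y e)" if "P k" for k
  proof -
    have "real k \<le> (\<Sum>e\<in>arcs G. real (Y e))"
      using that flow_value_le_capacities[OF finite_arcs]
      by (fastforce simp: P_def integer_flow_of_value_def)
    then show ?thesis
      by (simp flip: of_nat_sum)
  qed
  ultimately have "P (Greatest P)" and greatest: "\<And>k. P k \<Longrightarrow> k \<le> Greatest P"
    by (blast intro: GreatestI_nat Greatest_le_nat)+
  then obtain f where f: "integer_flow_of_value G UE n Y (Greatest P) f"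
    by (auto simp: P_def)
  have "\<not> has_path (residual_network G UE Y f) 1 n"
  proof
    assume "has_path (residual_network G UE Y f) 1 n"
    then have "P (Suc (Greatest P))"
      unfolding P_def[of "Suc (Greatest P)"] by (rule augmenting_path[OF assms(1,3) f])
    then show False
      using greatest by fastforce
  qed
  then have max: "flow_value G g \<le> real (Greatest P)" if "feasible_flow G UE n Y g" for g
    using flow_maximum_if_no_residual_path[OF assms(1,2) _ that] f
    by (metis integer_flow_of_value_def)
  then have "max_flow_value G UE n Y = real (Greatest P)"
    using f max_flow_value_eqI[of G UE n Y f] by (simp add: integer_flow_of_value_def)
  from f this max show thesis
    by (rule that)
qed

lemma flow_value_le_max_flow_value:
  assumes "fin_digraph G" "1 \<in> verts G" "1 \<noteq> n" "feasible_flow G UE n Y g"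
  shows "flow_value G g \<le> max_flow_value G UE n Y"
  using ex_maximum_integer_flow[OF assms(1-3), of UE Y] assms(4) by metis

lemma has_residual_path_iff_not_maximum:
  assumes "fin_digraph G" "1 \<in> verts G" "1 \<noteq> n"
    and f: "integer_flow_of_value G UE n Y k f"
  shows "has_path (residual_network G UE Y f) 1 n \<longleftrightarrow> real k < max_flow_value G UE n Y"
proof
  assume "has_path (residual_network G UE Y f) 1 n"
  then obtain g where "integer_flow_of_value G UE n Y (Suc k) g"
    using augmenting_path[OF assms(1,3) f] by blast
  then have "real (Suc k) \<le> max_flow_value G UE n Y"
    using flow_value_le_max_flow_value[OF assms(1-3), of UE Y g]
    by (simp add: integer_flow_of_value_def)
  then show "real k < max_flow_value G UE n Y"
    by simp
next
  assume less: "real k < max_flow_value G UE n Y"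
  show "has_path (residual_network G UE Y f) 1 n"
  proof (rule ccontr)
    assume "\<not> has_path (residual_network G UE Y f) 1 n"
    then have "max_flow_value G UE n Y = flow_value G f"
      using f flow_maximum_if_no_residual_path[OF assms(1,2)] max_flow_value_eqI
      by (metis integer_flow_of_value_def)
    with less f show False
      by (simp add: integer_flow_of_value_def)
  qed
qed

section \<open>Recognising minimal capacity vectors\<close>

theorem theorem1:
  fixes G :: "(nat, 'e) pre_digraph" and UE :: "'e set" and n d :: nat
    and W X :: "'e \<Rightarrow> nat"
  assumes "stochastic_flow_network G UE n"
    and "0 < d"
    and "d_MC_candidate G UE n W d X"
    and "max_flow_value G UE n X = real d"
  shows "(\<forall>e\<in>unsaturated G W X.
            \<exists>f. integer_flow_of_value G UE n (add_state X (unit_state e)) d f) \<and>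
         (\<forall>F. (\<forall>e\<in>unsaturated G W X.
                 integer_flow_of_value G UE n (add_state X (unit_state e)) d (F e)) \<longrightarrow>
           (d_MC G UE n W d X \<longleftrightarrow>
             (\<forall>e\<in>unsaturated G W X.
               has_path (residual_network G UE (add_state X (unit_state e)) (F e)) 1 n)))"
proof -
  have network: "fin_digraph G" "1 \<in> verts G" "1 \<noteq> n"
    using assms(1) by (auto simp: stochastic_flow_network_def)
  obtain f where f: "integer_flow_of_value G UE n X d f"
    using ex_maximum_integer_flow[OF network, of UE X] assms(4) by (metis of_nat_eq_iff)
  have "system_state G W X"
    using assms(3) by (auto simp: d_MC_candidate_def d_MC_candidate_from_def)
  have "integer_flow_of_value G UE n (add_state X (unit_state e)) d f" for e
    using f feasible_flow_mono[of G UE n X f "add_state X (unit_state e)"]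
    by (simp add: integer_flow_of_value_def add_state_def)
  moreover have "d_MC G UE n W d X \<longleftrightarrow>
      (\<forall>e\<in>unsaturated G W X.
        has_path (residual_network G UE (add_state X (unit_state e)) (F e)) 1 n)"
    if "\<forall>e\<in>unsaturated G W X.
      integer_flow_of_value G UE n (add_state X (unit_state e)) d (F e)" for F
    unfolding d_MC_def
    using that assms(4) \<open>system_state G W X\<close> has_residual_path_iff_not_maximum[OF network]
    by blast
  ultimately show ?thesis
    by blast
qed

end
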